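(* Let $p\ge 1$, and let $\mathbf{\Sigma}:\mathbf{x}\mapsto\mathbf{\Sigma}_{\mathbf{x}}$ be a mapping from $\mathbb{R}^p$ to the set of real symmetric positive definite $p\times p$ matrices. Let $R^S$ be a continuous isotropic stationary correlation function (so $R^S(0)=1$) that is positive definite on $\mathbb{R}^q$ for all integers $q\ge1$. Let $M=\lambda\mu$, with $\lambda>0$ and $\mu$ a probability measure on $\mathbb{R}_+$, and let $g(\cdot\,;t)$, $t\in\mathbb{R}_+$, be a family of functions on $\mathbb{R}^p$ such that $g(\mathbf{x};\cdot)\in L^2(M)$ for all $\mathbf{x}\in\mathbb{R}^p$. Consider the class of non-stationary covariance functions $$C^{NS}(\mathbf{x},\mathbf{y})=\pi^{-\frac p2}\left|\frac{\mathbf{\Sigma}_{\mathbf{x}}+\mathbf{\Sigma}_{\mathbf{y}}}{2}\right|^{-\frac12}\int_0^{+\infty}g(\mathbf{x};t)g(\mathbf{y};t)\,t^{-p}\exp\left(-\frac{Q_{\mathbf{x}\mathbf{y}}(\mathbf{x}-\mathbf{y})}{t^2}\right)M(dt).$$ If $g(\mathbf{x};t)\propto 1$ (that is, $g$ equals a nonzero constant, independent of $\mathbf{x}$ and $t$) and $M(dt)=t^p\,\xi(dt)$, where $\xi$ is a finite positive measure on $\mathbb{R}_+$ such that $$R^S(\tau)=\int_0^{+\infty}\exp\left(-\frac{\tau^2}{t^2}\right)\xi(dt),\qquad \tau\ge 0,$$ then the correlation function generated, $R^{NS}(\mathbf{x},\mathbf{y})=C^{NS}(\mathbf{x},\mathbf{y})/\sqrt{C^{NS}(\mathbf{x},\mathbf{x})\,C^{NS}(\mathbf{y},\mathbf{y})}$,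 is, for all $\mathbf{x},\mathbf{y}\in\mathbb{R}^p$, $$R^{NS}(\mathbf{x},\mathbf{y})=\phi_{\mathbf{x}\mathbf{y}}\,R^S\left(\sqrt{Q_{\mathbf{x}\mathbf{y}}(\mathbf{x}-\mathbf{y})}\right).$$
   Context: Here $|A|$ denotes the determinant of a matrix $A$; for $\mathbf{h}\in\mathbb{R}^p$, $Q_{\mathbf{x}\mathbf{y}}(\mathbf{h})=\mathbf{h}^T\left(\frac{\mathbf{\Sigma}_{\mathbf{x}}+\mathbf{\Sigma}_{\mathbf{y}}}{2}\right)^{-1}\mathbf{h}$; and $\phi_{\mathbf{x}\mathbf{y}}=|\mathbf{\Sigma}_{\mathbf{x}}|^{\frac14}|\mathbf{\Sigma}_{\mathbf{y}}|^{\frac14}\left|\frac{\mathbf{\Sigma}_{\mathbf{x}}+\mathbf{\Sigma}_{\mathbf{y}}}{2}\right|^{-\frac12}$. An isotropic function $R^S:[0,\infty)\to\mathbb{R}$ is positive definite on $\mathbb{R}^q$ if $(\mathbf{x},\mathbf{y})\mapsto R^S(\|\mathbf{x}-\mathbf{y}\|)$ is a positive definite kernel on $\mathbb{R}^q$. The function $C^{NS}$ is the covariance of the random function $Z(\mathbf{x})=\int_{\mathbb{R}^p}g(\mathbf{x};T(\mathbf{u}))\,k_{\mathbf{x}}(\mathbf{u};T(\mathbf{u}))\,W(d\mathbf{u})$, where $W$ is a centered orthogonal random measure on $\mathbb{R}^p$ with $\mathbb{E}(W(d\mathbf{u})W(d\mathbf{v}))=\lambda\,\delta_{\mathbf{u}}(d\mathbf{v})\,d\mathbf{u}$,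 the $T(\mathbf{u})$ are i.i.d. with law $\mu$ and independent of $W$, and $k_{\mathbf{x}}(\cdot\,;t)$ is the $p$-variate Gaussian density with mean $\mathbf{x}$ and covariance matrix $\frac{t^2}{4}\mathbf{\Sigma}_{\mathbf{x}}$. The integrals in $t$ are understood over $t>0$. *)

theory Defs
  imports "HOL-Probability.Probability"
begin

text \<open>Points of the Euclidean space of dimension \<open>p\<close> are of type \<open>real ^ 'n\<close> with \<open>p = CARD('n)\<close>.
  Measures on the half line \<open>[0, \<infinity>)\<close> are measures on the Borel sigma-algebra of \<open>{0..}\<close>; the
  integrals in \<open>t\<close> are taken over \<open>t > 0\<close>, so that an atom at \<open>0\<close> does not contribute to them.\<close>

definition borel_nonneg :: "real measure" where
  "borel_nonneg = restrict_space borel {0..}"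

definition sym_pos_def :: "real ^ 'n ^ 'n \<Rightarrow> bool" where
  "sym_pos_def A \<longleftrightarrow> transpose A = A \<and> (\<forall>v. v \<noteq> 0 \<longrightarrow> v \<bullet> (A *v v) > 0)"

text \<open>As usual for covariances, a positive definite kernel is symmetric and its quadratic
  forms are nonnegative, not necessarily strictly positive.\<close>

definition pos_def_kernel :: "'a set \<Rightarrow> ('a \<Rightarrow> 'a \<Rightarrow> real) \<Rightarrow> bool" where
  "pos_def_kernel X K \<longleftrightarrow>
     (\<forall>x\<in>X. \<forall>y\<in>X. K x y = K y x) \<and>
     (\<forall>(n::nat) (x :: nat \<Rightarrow> 'a) (a :: nat \<Rightarrow> real). (\<forall>i<n. x i \<in> X) \<longrightarrow>
        (\<Sum>i<n. \<Sum>j<n. a i * a j * K (x i) (x j)) \<ge> 0)"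

text \<open>Here the dimension \<open>q\<close> is quantified inside the hypotheses of the theorem, hence cannot be
  a type: points of dimension \<open>q\<close> are functions on \<open>{..<q}\<close> and \<open>L2_set\<close> is the Euclidean norm.\<close>

definition isotropic_pos_def :: "nat \<Rightarrow> (real \<Rightarrow> real) \<Rightarrow> bool" where
  "isotropic_pos_def q R \<longleftrightarrow>
     pos_def_kernel ({..<q} \<rightarrow>\<^sub>E (UNIV :: real set)) (\<lambda>x y. R (L2_set (\<lambda>i. x i - y i) {..<q}))"

definition mean_cov :: "(real ^ 'n \<Rightarrow> real ^ 'n ^ 'n) \<Rightarrow> real ^ 'n \<Rightarrow> real ^ 'n \<Rightarrow> real ^ 'n ^ 'n" where
  "mean_cov S x y = (1 / 2) *\<^sub>R (S x + S y)"

definition Q :: "(real ^ 'n \<Rightarrow> real ^ 'n ^ 'n) \<Rightarrow> real ^ 'n \<Rightarrow> real ^ 'n \<Rightarrow> real ^ 'n \<Rightarrow> real" where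
  "Q S x y h = h \<bullet> (matrix_inv (mean_cov S x y) *v h)"

definition phi :: "(real ^ 'n \<Rightarrow> real ^ 'n ^ 'n) \<Rightarrow> real ^ 'n \<Rightarrow> real ^ 'n \<Rightarrow> real" where
  "phi S x y =
     det (S x) powr (1 / 4) * det (S y) powr (1 / 4) * det (mean_cov S x y) powr (- 1 / 2)"

definition C_NS ::
  "(real ^ 'n \<Rightarrow> real ^ 'n ^ 'n) \<Rightarrow> (real ^ 'n \<Rightarrow> real \<Rightarrow> real) \<Rightarrow> real measure
     \<Rightarrow> real ^ 'n \<Rightarrow> real ^ 'n \<Rightarrow> real" where
  "C_NS S g M x y =
     pi powr (- real CARD('n) / 2) * det (mean_cov S x y) powr (- 1 / 2) *
     (LINT t:{0<..}|M. g x t * g y t * t powi (- int CARD('n)) * exp (- (Q S x y (x - y) / t\<^sup>2)))"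

definition R_NS ::
  "(real ^ 'n \<Rightarrow> real ^ 'n ^ 'n) \<Rightarrow> (real ^ 'n \<Rightarrow> real \<Rightarrow> real) \<Rightarrow> real measure
     \<Rightarrow> real ^ 'n \<Rightarrow> real ^ 'n \<Rightarrow> real" where
  "R_NS S g M x y = C_NS S g M x y / sqrt (C_NS S g M x x * C_NS S g M y y)"

end

theory Submission
  imports Defs
begin

text \<open>The factor \<open>t\<^sup>p\<close> in \<open>M\<close> cancels the factor \<open>t\<^sup>-\<^sup>p\<close> in the integrand, so that
  \<open>C\<^sup>N\<^sup>S\<close> is a constant times a determinant times \<open>R\<^sup>S\<close> at the root of the quadratic form. On
  the diagonal the form vanishes and \<open>R\<^sup>S(0) = 1\<close>, so the constant cancels in the correlation and
  only \<open>\<phi>\<close> remains as a prefactor.\<close>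

lemma sym_pos_def_pos: "sym_pos_def A \<Longrightarrow> v \<noteq> 0 \<Longrightarrow> 0 < v \<bullet> (A *v v)"
  by (simp add: sym_pos_def_def)

lemma sym_pos_def_nonneg: "sym_pos_def A \<Longrightarrow> 0 \<le> v \<bullet> (A *v v)"
  by (cases "v = 0") (auto dest: sym_pos_def_pos)

lemma sym_pos_def_mat_1: "sym_pos_def (mat 1)"
  by (simp add: sym_pos_def_def transpose_mat)

lemma sym_pos_def_add:
  assumes "sym_pos_def A" "sym_pos_def B"
  shows "sym_pos_def (A + B)"
  using assms
  by (auto simp: sym_pos_def_def transpose_def vec_eq_iff matrix_vector_mult_add_rdistrib
      inner_add_right add_pos_pos)

lemma sym_pos_def_scaleR:
  assumes "sym_pos_def A" "0 < r"
  shows "sym_pos_def (r *\<^sub>R A)"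
  using assms
  by (auto simp: sym_pos_def_def transpose_def vec_eq_iff scaleR_matrix_vector_assoc [symmetric])

text \<open>A kernel vector makes the quadratic form vanish, so positivity forces it to be
  zero.\<close>

lemma invertible_sym_pos_def:
  assumes "sym_pos_def A"
  shows "invertible A"
proof -
  have "v = 0" if "A *v v = 0" for v
    using sym_pos_def_pos [OF assms, of v] that by (cases "v = 0") auto
  then show ?thesis
    by (auto simp: invertible_left_inverse matrix_left_invertible_ker)
qed

text \<open>The determinant has no zero on the segment from the identity to \<open>A\<close>, hence keeps its sign.\<close>

lemma det_sym_pos_def:
  assumes A: "sym_pos_def A"
  shows "0 < det A"
proof (rule ccontr)
  define B where "B = (\<lambda>s::real. (1 - s) *\<^sub>R mat 1 + s *\<^sub>R A)"
  assume "\<not> 0 < det A"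
  moreover have "continuous_on {0..1} (\<lambda>s. det (B s))"
    unfolding B_def det_def by (intro continuous_intros)
  ultimately obtain s where s: "0 \<le> s" "s \<le> 1" "det (B s) = 0"
    using IVT2' [of "\<lambda>s. det (B s)" 1 0 0] by (auto simp: B_def)
  have "sym_pos_def (B s)"
  \<comment> \<open>The endpoints are separate because \<open>sym_pos_def_scaleR\<close> asks for a
    strictly positive factor.\<close>
  proof (cases "s = 0 \<or> s = 1")
    case True
    then show ?thesis by (auto simp: B_def A sym_pos_def_mat_1)
  next
    case False
    then show ?thesis
      using s by (auto simp: B_def intro!: sym_pos_def_add sym_pos_def_scaleR sym_pos_def_mat_1 A)
  qed
  then show False
    using s invertible_det_nz invertible_sym_pos_def by blast
qed

text \<open>Substituting \<open>h = A *v w\<close> turns the form of the inverse at \<open>h\<close>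
  into the form of \<open>A\<close> at \<open>w\<close>.\<close>

lemma matrix_inv_quadratic_form_nonneg:
  assumes "sym_pos_def A"
  shows "0 \<le> h \<bullet> (matrix_inv A *v h)"
proof -
  define w where "w = matrix_inv A *v h"
  have "A *v w = h"
    \<comment> \<open>\<open>matrix_inv\<close> is a choice term; invertibility guarantees that the
      chosen matrix is an inverse.\<close>
    using someI_ex [OF invertible_sym_pos_def [OF assms, unfolded invertible_def]]
    by (simp add: w_def matrix_vector_mul_assoc matrix_inv_def)
  then show ?thesis
    using sym_pos_def_nonneg [OF assms, of w] by (simp add: w_def inner_commute)
qed

lemma sym_pos_def_mean_cov:
  "sym_pos_def (S x) \<Longrightarrow> sym_pos_def (S y) \<Longrightarrow> sym_pos_def (mean_cov S x y)"
  unfolding mean_cov_def by (intro sym_pos_def_scaleR sym_pos_def_add) auto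

lemma mean_cov_same [simp]: "mean_cov S x x = S x"
  by (simp add: mean_cov_def scaleR_2 [symmetric])

lemma Q_zero [simp]: "Q S x y 0 = 0"
  by (simp add: Q_def)

text \<open>The powers cancel pointwise for \<open>t > 0\<close>, and the indicator removes
  \<open>t = 0\<close>. The density is nonnegative because \<open>\<xi>\<close> lives on the half
  line.\<close>

lemma set_integral_density_power:
  fixes f :: "real \<Rightarrow> real"
  assumes sets: "sets \<xi> = sets borel_nonneg"
    and f: "f \<in> borel_measurable borel"
  shows "(LINT t:{0<..}|density \<xi> (\<lambda>t. ennreal (t ^ n)). t powi (- int n) * f t)
    = (LINT t:{0<..}|\<xi>. f t)"
proof -
  have space: "space \<xi> = {0..}"
    using sets_eq_imp_space_eq [OF sets] by (simp add: borel_nonneg_def space_restrict_space)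
  have borel: "h \<in> borel_measurable \<xi>" if "h \<in> borel_measurable borel" for h :: "real \<Rightarrow> real"
    using that by (subst measurable_cong_sets [OF sets refl])
      (simp add: borel_nonneg_def measurable_restrict_space1)
  have "(\<lambda>t::real. t powi (- int n)) \<in> borel_measurable borel"
    by (simp add: power_int_minus)
  then show ?thesis
    unfolding set_lebesgue_integral_def using f
    by (subst integral_density)
      (auto simp: space power_int_minus indicator_def intro!: borel AE_I2 Bochner_Integration.integral_cong)
qed

lemma C_NS_const:
  fixes S :: "real ^ 'n \<Rightarrow> real ^ 'n ^ 'n"
  assumes g: "\<And>x t. t \<ge> 0 \<Longrightarrow> g x t = c"
    and sets: "sets \<xi> = sets borel_nonneg"
  shows "C_NS S g (density \<xi> (\<lambda>t. ennreal (t ^ CARD('n)))) x y =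
    pi powr (- real CARD('n) / 2) * c\<^sup>2 * det (mean_cov S x y) powr (- 1 / 2) *
    (LINT t:{0<..}|\<xi>. exp (- (Q S x y (x - y) / t\<^sup>2)))"
proof -
  let ?D = "density \<xi> (\<lambda>t. ennreal (t ^ CARD('n)))"
  let ?e = "\<lambda>t. exp (- (Q S x y (x - y) / t\<^sup>2))"
  have "(LINT t:{0<..}|?D. g x t * g y t * t powi (- int CARD('n)) * ?e t)
      = (LINT t:{0<..}|?D. t powi (- int CARD('n)) * (c\<^sup>2 * ?e t))"
    unfolding set_lebesgue_integral_def
    by (intro Bochner_Integration.integral_cong)
      (auto simp: indicator_def g power2_eq_square)
  also have "\<dots> = (LINT t:{0<..}|\<xi>. c\<^sup>2 * ?e t)"
    by (rule set_integral_density_power [OF sets]) simp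
  finally show ?thesis
    by (simp add: C_NS_def)
qed

theorem corollary3p2:
  fixes S :: "real ^ 'n \<Rightarrow> real ^ 'n ^ 'n"
    and RS :: "real \<Rightarrow> real"
    and lam c :: real
    and \<mu> M \<xi> :: "real measure"
    and g :: "real ^ 'n \<Rightarrow> real \<Rightarrow> real"
  assumes S: "\<And>x. sym_pos_def (S x)"
    and RS_cont: "continuous_on {0..} RS"
    and RS_0: "RS 0 = 1"
    and RS_pos_def: "\<And>q. q \<ge> 1 \<Longrightarrow> isotropic_pos_def q RS"
    and lam: "lam > 0"
    and \<mu>: "prob_space \<mu>" "sets \<mu> = sets borel_nonneg"
    and M: "M = scale_measure (ennreal lam) \<mu>"
    and g_L2: "\<And>x. g x \<in> borel_measurable M" "\<And>x. integrable M (\<lambda>t. (g x t)\<^sup>2)"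
    and g_const: "c \<noteq> 0" "\<And>x t. t \<ge> 0 \<Longrightarrow> g x t = c"
    and \<xi>: "finite_measure \<xi>" "sets \<xi> = sets borel_nonneg"
    and M_\<xi>: "M = density \<xi> (\<lambda>t. ennreal (t ^ CARD('n)))"
    and RS_\<xi>: "\<And>\<tau>. \<tau> \<ge> 0 \<Longrightarrow> RS \<tau> = (LINT t:{0<..}|\<xi>. exp (- (\<tau>\<^sup>2 / t\<^sup>2)))"
  shows "\<forall>x y. R_NS S g M x y = phi S x y * RS (sqrt (Q S x y (x - y)))"
proof (intro allI)
  fix x y
  let ?K = "pi powr (- real CARD('n) / 2) * c\<^sup>2"
  have K: "0 < ?K"
    using g_const(1) by simp
  have C: "C_NS S g M u v =
      ?K * det (mean_cov S u v) powr (- 1 / 2) * RS (sqrt (Q S u v (u - v)))" for u v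
  proof -
    \<comment> \<open>This makes the square of \<open>sqrt (Q S u v (u - v))\<close> the form
      itself, so that \<open>RS_\<xi>\<close> at this root yields the integral in
      \<open>C_NS_const\<close>.\<close>
    have "0 \<le> Q S u v (u - v)"
      unfolding Q_def by (intro matrix_inv_quadratic_form_nonneg sym_pos_def_mean_cov S)
    then show ?thesis
      by (simp add: M_\<xi> C_NS_const [OF g_const(2) \<xi>(2)] RS_\<xi>)
  qed
  have diag: "C_NS S g M u u = ?K * det (S u) powr (- 1 / 2)" for u
    by (simp add: C RS_0)
  have pos: "0 < det (S u)" for u
    by (rule det_sym_pos_def [OF S])
  \<comment> \<open>Written as a square, each diagonal factor leaves the square root as a fourth
    root of a determinant, which is where the exponents \<open>1 / 4\<close> in \<open>phi\<close>
    come from.\<close>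
  have half: "det (S u) powr (- 1 / 2) = (1 / det (S u) powr (1 / 4))\<^sup>2" for u
    using pos [of u] by (simp add: powr_minus_divide power_one_over powr_power)
  have "sqrt (C_NS S g M x x * C_NS S g M y y)
      = ?K / (det (S x) powr (1 / 4) * det (S y) powr (1 / 4))"
    unfolding diag half using K
    by (intro real_sqrt_unique) (simp_all add: power2_eq_square)
  then have "R_NS S g M x y =
      C_NS S g M x y / (?K / (det (S x) powr (1 / 4) * det (S y) powr (1 / 4)))"
    by (simp only: R_NS_def)
  then show "R_NS S g M x y = phi S x y * RS (sqrt (Q S x y (x - y)))"
    using g_const(1) by (simp add: C phi_def)
qed

end
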